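(* Let $A\in\mathbb{R}^{n\times n}$ be a non-negative matrix which is irreducible and marginally stable. Let $v,w\in\mathbb{R}^n$ be the (positive) right and left leading eigenvectors of $A$, and let the non-negative constant $\sigma_2$ be the second largest eigenvalue (counted with multiplicity) of the symmetric positive semidefinite matrix $A^S=\Pi^{1/2}A\,\Pi^{-1}A^\top\Pi\,\Pi^{-1/2}$, where $\Pi=\mathrm{diag}(w_1/v_1,\dots,w_n/v_n)$. If the product $AA^\top$ is primitive, then $$\lambda_{\min}(\mathcal{W}_{\mathcal{K},T})\le \frac{\max_i\{w_i/v_i\}}{\min_i\{w_i/v_i\}}\;\frac{\sigma_2^{\frac{n}{m}}}{\sigma_2^{2}\,(1-\sigma_2)}$$ for all $T\in\mathbb{N}$ and all sets $\mathcal{K}\subseteq\{1,\dots,n\}$ with cardinality $m$, where $\mathcal{W}_{\mathcal{K},T}$ is the controllability Gramian associated with $A$, $\mathcal{K}$ and $T$, and $\lambda_{\min}$ denotes the smallest eigenvalue.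
   Context: A matrix is non-negative (positive) if all its entries are $\ge 0$ ($>0$). A non-negative matrix $A\in\mathbb{R}^{n\times n}$ is irreducible if $(I_n+A)^k$ is positive for some $k\in\mathbb{N}$, and primitive if $A^k$ is positive for some $k\in\mathbb{N}$. $A$ is (Schur) marginally stable if $\|A^t\|_2$ is bounded in $t$ ($t=0,1,2,\dots$). For $A$ non-negative, irreducible and marginally stable there is a unique real eigenvalue $\lambda_1$ with $1\ge\lambda_1\ge|\lambda|$ for every eigenvalue $\lambda$ of $A$, and there are positive vectors $v,w$ (unique up to positive scaling) with $Av=\lambda_1 v$ and $A^\top w=\lambda_1 w$; these are the right and left leading eigenvectors. They can be normalized so that $\sum_i w_i/v_i=1$. Set $\pi_i=w_i/v_i$, $\Pi=\mathrm{diag}(\pi_1,\dots,\pi_n)$, $A^R=\Pi^{-1}A^\top\Pi$ and $A^S=\Pi^{1/2}AA^R\Pi^{-1/2}$. The matrix $A^S$ is symmetric positive semidefinite, with eigenvalues $\sigma_1\ge\sigma_2\ge\dots\ge\sigma_n\ge0$. For $\mathcal{K}=\{k_1,\dots,k_m\}\subseteq\{1,\dots,n\}$ (the control nodes), $m=|\mathcal{K}|$, let $B_{\mathcal{K}}=[e_{k_1}\cdots e_{k_m}]\in\mathbb{R}^{n\times m}$, where $e_k$ is the $k$-th canonical basis vector. The controllability Gramian of the system $x(t+1)=Ax(t)+B_{\mathcal{K}}u_{\mathcal{K}}(t)$ is $$\mathcal{W}_{\mathcal{K},T}=\sum_{\tau=0}^{T-1}A^\tau B_{\mathcal{K}}B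_{\mathcal{K}}^\top(A^\top)^\tau.$$
   Formalization: n ≥ 2 is assumed so that σ₂ exists; when σ₂ = 0 the right-hand quotient is 0/0 and is read as σ₂^{n/m−2}/(1−σ₂): 0 if n/m > 2, 1 if n/m = 2, and no claim (infinite bound) if n/m < 2. *)

theory Defs
  imports "HOL-Analysis.Analysis" "HOL-Computational_Algebra.Polynomial"
begin

(* The powers t ^ k and the product t * t on the type of vectors are componentwise,
   so powers with respect to ** have to be defined separately. *)
primrec matrix_pow :: "'a::semiring_1^'n^'n \<Rightarrow> nat \<Rightarrow> 'a^'n^'n" where
  "matrix_pow A 0 = mat 1"
| "matrix_pow A (Suc k) = A ** matrix_pow A k"

definition nonneg_matrix :: "real^'n^'m \<Rightarrow> bool" where
  "nonneg_matrix A \<longleftrightarrow> (\<forall>i j. 0 \<le> A $ i $ j)"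

definition pos_matrix :: "real^'n^'m \<Rightarrow> bool" where
  "pos_matrix A \<longleftrightarrow> (\<forall>i j. 0 < A $ i $ j)"

definition irreducible_matrix :: "real^'n^'n \<Rightarrow> bool" where
  "irreducible_matrix A \<longleftrightarrow> (\<exists>k. pos_matrix (matrix_pow (mat 1 + A) k))"

definition primitive_matrix :: "real^'n^'n \<Rightarrow> bool" where
  "primitive_matrix A \<longleftrightarrow> (\<exists>k. pos_matrix (matrix_pow A k))"

(* onorm is taken with respect to the Euclidean norm, so it is the spectral norm here. *)
definition marginally_stable :: "real^'n^'n \<Rightarrow> bool" where
  "marginally_stable A \<longleftrightarrow> bounded (range (\<lambda>t. onorm ((*v) (matrix_pow A t))))"

definition is_eigval :: "'a::field^'n^'n \<Rightarrow> 'a \<Rightarrow> bool" where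
  "is_eigval M c \<longleftrightarrow> (\<exists>x. x \<noteq> 0 \<and> M *v x = c *s x)"

(* The second condition ranges over all complex eigenvalues of the real matrix A. *)
definition leading_eigval :: "real^'n^'n \<Rightarrow> real \<Rightarrow> bool" where
  "leading_eigval A l \<longleftrightarrow>
     is_eigval A l \<and> (\<forall>\<mu>. is_eigval (map_matrix complex_of_real A) \<mu> \<longrightarrow> cmod \<mu> \<le> l)"

definition charpoly :: "'a::comm_ring_1^'n^'n \<Rightarrow> 'a poly" where
  "charpoly M = det (mat [:0, 1:] - map_matrix (\<lambda>c. [:c:]) M)"

(* The real eigenvalues in decreasing order, repeated according to their multiplicity as
   roots of the characteristic polynomial. A symmetric M has CARD('n) of them. *)
definition eigvals_desc :: "real^'n^'n \<Rightarrow> real list" where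
  "eigvals_desc M = rev (sorted_list_of_multiset (proots (charpoly M)))"

(* Meant for symmetric matrices, whose set of real eigenvalues is nonempty. *)
definition lambda_min :: "real^'n^'n \<Rightarrow> real" where
  "lambda_min M = Min {c. is_eigval M c}"

definition diag :: "'a::zero^'n \<Rightarrow> 'a^'n^'n" where
  "diag d = (\<chi> i j. if i = j then d $ i else 0)"

definition Pi_pow :: "real^'n \<Rightarrow> real^'n \<Rightarrow> real \<Rightarrow> real^'n^'n" where
  "Pi_pow v w p = diag (\<chi> i. (w $ i / v $ i) powr p)"

definition A_R :: "real^'n^'n \<Rightarrow> real^'n \<Rightarrow> real^'n \<Rightarrow> real^'n^'n" where
  "A_R A v w = Pi_pow v w (-1) ** transpose A ** Pi_pow v w 1"

definition A_S :: "real^'n^'n \<Rightarrow> real^'n \<Rightarrow> real^'n \<Rightarrow> real^'n^'n" where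
  "A_S A v w = Pi_pow v w (1/2) ** A ** A_R A v w ** Pi_pow v w (-1/2)"

definition gramian :: "real^'n^'n \<Rightarrow> real^'m^'n \<Rightarrow> nat \<Rightarrow> real^'n^'n" where
  "gramian A B T =
     (\<Sum>\<tau><T. matrix_pow A \<tau> ** B ** transpose B ** matrix_pow (transpose A) \<tau>)"

(* B_K with its columns indexed by all nodes: column k is e_k for k in K and 0 otherwise.
   Indexing by all nodes allows K to be an arbitrary set instead of the range of an
   enumeration by a type of cardinality m; the zero columns do not affect the Gramian,
   see gramian_input_matrix. *)
definition input_matrix :: "'n set \<Rightarrow> real^'n^'n" where
  "input_matrix K = (\<chi> i k. if k \<in> K then axis k 1 $ i else 0)"

lemma gramian_input_matrix:
  fixes k :: "'m::finite \<Rightarrow> 'n::finite" and A :: "real^'n^'n"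
  assumes "inj k"
  shows "gramian A (input_matrix (range k)) T = gramian A (\<chi> i j. axis (k j) 1 $ i) T"
proof -
  have "input_matrix (range k) ** transpose (input_matrix (range k))
      = (\<chi> i j. axis (k j) 1 $ i) ** transpose (\<chi> i j. axis (k j) (1::real) $ i)"
    (is "?L = ?R")
  proof -
    have "?L $ i $ j = ?R $ i $ j" for i j
    proof -
      have "?L $ i $ j = (\<Sum>l\<in>UNIV. if l \<in> range k then axis l 1 $ i * axis l (1::real) $ j else 0)"
        by (auto simp: matrix_matrix_mult_def transpose_def input_matrix_def intro!: sum.cong)
      also have "\<dots> = (\<Sum>l\<in>range k. axis l 1 $ i * axis l 1 $ j)"
        by (simp add: sum.If_cases)
      also have "\<dots> = (\<Sum>l\<in>UNIV. axis (k l) 1 $ i * axis (k l) 1 $ j)"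
        by (subst sum.reindex) (use assms in auto)
      also have "\<dots> = ?R $ i $ j"
        by (simp add: matrix_matrix_mult_def transpose_def)
      finally show ?thesis .
    qed
    then show ?thesis by (simp add: vec_eq_iff)
  qed
  then show ?thesis
    unfolding gramian_def by (simp flip: matrix_mul_assoc)
qed

lemma poly_charpoly:
  fixes M :: "'a::comm_ring_1^'n^'n"
  shows "poly (charpoly M) c = det (mat c - M)"
proof -
  have "poly ((mat [:0, 1:] - map_matrix (\<lambda>c. [:c:]) M) $ i $ j) c = (mat c - M) $ i $ j" for i j
    by (simp add: mat_def)
  then show ?thesis
    unfolding charpoly_def det_def by (simp add: poly_sum poly_prod)
qed

lemma is_eigval_iff_charpoly:
  fixes M :: "'a::field^'n^'n"
  shows "is_eigval M c \<longleftrightarrow> poly (charpoly M) c = 0"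
proof -
  have "(mat c - M) *v x = c *s x - M *v x" for x
  proof -
    have "mat c *v x = c *s x"
      by (simp add: vec_eq_iff matrix_vector_mult_def mat_def if_distrib[of "\<lambda>y. y * _"] cong: if_cong)
    then show ?thesis by (simp add: matrix_vector_mult_diff_rdistrib)
  qed
  then have "is_eigval M c \<longleftrightarrow> (\<exists>x. x \<noteq> 0 \<and> (mat c - M) *v x = 0)"
    by (auto simp: is_eigval_def)
  also have "\<dots> \<longleftrightarrow> det (mat c - M) = 0"
    by (metis invertible_det_nz invertible_left_inverse matrix_left_invertible_ker)
  finally show ?thesis by (simp add: poly_charpoly)
qed

lemma set_eigvals_desc: "set (eigvals_desc M) = {c. is_eigval M c}"
proof -
  have "\<not> is_eigval M (onorm ((*v) M) + 1)"
  proof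
    assume "is_eigval M (onorm ((*v) M) + 1)"
    then obtain x where x: "x \<noteq> 0" "M *v x = (onorm ((*v) M) + 1) *s x"
      by (auto simp: is_eigval_def)
    have "norm (M *v x) \<le> onorm ((*v) M) * norm x"
      by (simp add: onorm matrix_vector_mul_bounded_linear)
    moreover have "0 \<le> onorm ((*v) M)"
      by (simp add: onorm_pos_le matrix_vector_mul_bounded_linear)
    moreover have "norm ((onorm ((*v) M) + 1) *s x) = \<bar>onorm ((*v) M) + 1\<bar> * norm x"
      by (simp add: scalar_mult_eq_scaleR)
    ultimately show False using x by (simp add: algebra_simps)
  qed
  then have "charpoly M \<noteq> 0" by (auto simp: is_eigval_iff_charpoly)
  then show ?thesis by (simp add: eigvals_desc_def is_eigval_iff_charpoly)
qed

end

theory Submission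
  imports Defs
begin

text \<open>
  Conjugation by the square root of \<open>\<Pi>\<close> turns \<open>A\<close> into the matrix
  \<open>M = \<Pi>\<^bsup>1/2\<^esup> A \<Pi>\<^bsup>-1/2\<^esup>\<close>, for which the right and the left leading
  eigenvector coincide: both are the positive vector \<open>u\<close> with entries \<open>sqrt (w\<^sub>i v\<^sub>i)\<close>
  (\<open>balance_leading_eigenvectors\<close>). Moreover \<open>A\<^sup>S\<close> is \<open>M\<close> times its transpose
  (\<open>A_S_eq_balance\<close>), so \<open>u\<close> is an eigenvector of \<open>A\<^sup>S\<close> for \<open>\<lambda>\<^sub>1\<^sup>2\<close>, and
  \<open>\<lambda>\<^sub>1\<^sup>2 \<le> 1\<close> by marginal stability. Primitivity of \<open>A A\<^sup>T\<close> carries over to \<open>A\<^sup>S\<close>, and it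
  makes this eigenvalue simple and strictly larger than all others. Hence \<open>\<sigma>\<^sub>2 < 1\<close>, and
  \<open>\<sigma>\<^sub>2\<close> is the maximum of the Rayleigh quotient of \<open>A\<^sup>S\<close> on the orthogonal complement of \<open>u\<close>.
  That complement is invariant under \<open>M\<^sup>T\<close>, and on it \<open>M\<^sup>T\<close> shrinks squared norms by the
  factor \<open>\<sigma>\<^sub>2\<close> (\<open>second_eigval_A_S\<close>).
  
  The bound then comes from a dimension count. Requiring a vector \<open>y\<close> to be orthogonal to
  \<open>u\<close>, and the entries of \<open>(M\<^sup>T)\<^sup>t y\<close> at the \<open>m\<close> control nodes to vanish for all \<open>t < s\<close>,
  imposes \<open>s m + 1\<close> linear conditions. As long as \<open>s m + 1 < n\<close>, some nonzero \<open>y\<close> satisfies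
  them (\<open>exists_orthogonal_with_vanishing_outputs\<close>). For this \<open>y\<close> only the times \<open>t \<ge> s\<close>
  contribute, so the energy observed at the control nodes is at most
  \<open>\<sigma>\<^sub>2\<^sup>s / (1 - \<sigma>\<^sub>2)\<close> times the squared norm of \<open>y\<close>, a geometric tail
  (\<open>sum_outputs_le\<close>). Inserting \<open>x = \<Pi>\<^bsup>1/2\<^esup> y\<close> into the Rayleigh quotient of the Gramian
  costs the ratio of the largest to the smallest entry of \<open>\<Pi>\<close>
  (\<open>lambda_min_gramian_le_power\<close>). The theorem is the case where \<open>s\<close> is \<open>n/m\<close> rounded up,
  minus 2, or 0 if that number is negative.
\<close>

section \<open>Rayleigh quotients of symmetric matrices\<close>

lemma inner_matrix_vector_transpose:
  fixes A :: "real^'n^'m"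
  shows "x \<bullet> (A *v y) = (transpose A *v x) \<bullet> y"
  by (simp add: dot_lmul_matrix)

text \<open>
  A maximiser of the Rayleigh quotient on the unit sphere of \<open>V\<close>, which exists by
  compactness, is a critical point of the quotient on \<open>V\<close>. Invariance of \<open>V\<close> places the
  defect \<open>\<mu> x - S x\<close> in \<open>V\<close>, so it is an admissible direction and must vanish.
\<close>

lemma symmetric_max_rayleigh_eigenvector:
  fixes S :: "real^'n^'n"
  assumes sym: "transpose S = S" and V: "subspace V" and z: "z \<in> V" "z \<noteq> 0"
    and inv: "\<And>x. x \<in> V \<Longrightarrow> S *v x \<in> V"
  obtains \<mu> x where "x \<in> V" "x \<noteq> 0" "S *v x = \<mu> *s x"
    "\<And>y. y \<in> V \<Longrightarrow> y \<bullet> (S *v y) \<le> \<mu> * (y \<bullet> y)"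
proof -
  have "compact (sphere 0 1 \<inter> V)"
    by (simp add: V closed_subspace compact_Int_closed)
  moreover have "z /\<^sub>R norm z \<in> sphere 0 1 \<inter> V"
    using z V by (simp add: subspace_scale)
  then have "sphere 0 1 \<inter> V \<noteq> {}" by blast
  moreover have "continuous_on (sphere 0 1 \<inter> V) (\<lambda>x. x \<bullet> (S *v x))"
    by (intro continuous_intros matrix_vector_mult_linear_continuous_on)
  ultimately obtain x where x: "x \<in> sphere 0 1 \<inter> V"
    and max: "\<And>y. y \<in> sphere 0 1 \<inter> V \<Longrightarrow> y \<bullet> (S *v y) \<le> x \<bullet> (S *v x)"
    using continuous_attains_sup[of "sphere 0 1 \<inter> V" "\<lambda>x. x \<bullet> (S *v x)"] by blast
  define \<mu> where "\<mu> = x \<bullet> (S *v x)"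
  define q where "q y = \<mu> * (y \<bullet> y) - y \<bullet> (S *v y)" for y
  have xx: "x \<bullet> x = 1" using x by (simp add: norm_eq_1)
  have q_nonneg: "0 \<le> q y" if y: "y \<in> V" for y
  proof (cases "y = 0")
    case False
    have "y /\<^sub>R norm y \<in> sphere 0 1 \<inter> V" using False y V by (simp add: subspace_scale)
    from max[OF this] have "(y \<bullet> (S *v y)) / (norm y)\<^sup>2 \<le> \<mu>"
      by (simp add: \<mu>_def matrix_vector_mult_scaleR divide_inverse power2_eq_square mult_ac)
    then show ?thesis
      using False by (simp add: q_def pos_divide_le_eq dot_square_norm)
  qed (simp add: q_def)
  define r where "r = \<mu> *\<^sub>R x - S *v x"
  have rV: "r \<in> V" unfolding r_def using x V inv by (auto intro!: subspace_diff subspace_scale)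
  (* The first variation of q at its minimiser x, in the direction of the defect r. *)
  have expand: "q (x - t *\<^sub>R r) = t\<^sup>2 * q r - 2 * t * (r \<bullet> r)" for t
  proof -
    have "x \<bullet> (S *v r) = r \<bullet> (S *v x)"
      using sym by (metis inner_commute inner_matrix_vector_transpose)
    then have "q (x - t *\<^sub>R r)
        = (\<mu> * (x \<bullet> x) - x \<bullet> (S *v x)) + t\<^sup>2 * q r - 2 * t * (\<mu> * (r \<bullet> x) - r \<bullet> (S *v x))"
      by (simp add: q_def matrix_vector_mult_diff_distrib matrix_vector_mult_scaleR
          inner_diff_left inner_diff_right algebra_simps power2_eq_square inner_commute)
    moreover have "\<mu> * (r \<bullet> x) - r \<bullet> (S *v x) = r \<bullet> r"
      by (simp add: r_def inner_diff_right)
    ultimately show ?thesis using xx by (simp add: \<mu>_def)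
  qed
  have "r = 0"
  proof (rule ccontr)
    assume "r \<noteq> 0"
    then have rr: "0 < r \<bullet> r" by simp
    have qr: "0 \<le> q r" by (rule q_nonneg[OF rV])
    (* A step so short that the quadratic term cannot compensate the linear decrease;
       the summand 1 covers q r = 0. *)
    define t where "t = (r \<bullet> r) / (q r + 1)"
    have t: "0 < t" using rr qr by (simp add: t_def)
    have "x - t *\<^sub>R r \<in> V" using x V rV by (auto intro!: subspace_diff subspace_scale)
    from q_nonneg[OF this] have "0 \<le> t * (t * q r - 2 * (r \<bullet> r))"
      unfolding expand by (simp add: algebra_simps power2_eq_square)
    then have "2 * (r \<bullet> r) \<le> t * q r" using t by (simp add: zero_le_mult_iff)
    moreover have "t * q r \<le> t * (q r + 1)" using t by simp
    moreover have "t * (q r + 1) = r \<bullet> r" using qr by (simp add: t_def)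
    ultimately show False using rr by linarith
  qed
  show ?thesis
  proof
    show "x \<in> V" "x \<noteq> 0" using x xx by auto
    show "S *v x = \<mu> *s x" using \<open>r = 0\<close> by (simp add: r_def scalar_mult_eq_scaleR)
    show "y \<bullet> (S *v y) \<le> \<mu> * (y \<bullet> y)" if "y \<in> V" for y
      using q_nonneg[OF that] by (simp add: q_def)
  qed
qed

lemma finite_eigvals: "finite {c. is_eigval (M :: real^'n^'n) c}"
  by (metis List.finite_set set_eigvals_desc)

lemma charpoly_nonzero: "charpoly (M :: real^'n^'n) \<noteq> 0"
proof
  assume "charpoly M = 0"
  then have "{c. is_eigval M c} = UNIV" by (simp add: is_eigval_iff_charpoly)
  then show False using finite_eigvals[of M] infinite_UNIV_char_0 by metis
qed

text \<open>
  The maximal Rayleigh quotient of \<open>- W\<close> is attained at an eigenvector, so its negative is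
  an eigenvalue of \<open>W\<close> below every Rayleigh quotient of \<open>W\<close>.
\<close>

lemma lambda_min_le_rayleigh:
  fixes W :: "real^'n^'n"
  assumes sym: "transpose W = W"
  shows "lambda_min W * (x \<bullet> x) \<le> x \<bullet> (W *v x)"
proof -
  have neg: "(- W) *v y = - (W *v y)" for y
    by (simp add: vec_eq_iff matrix_vector_mult_def sum_negf)
  have symneg: "transpose (- W) = - W" using sym by (simp add: transpose_def vec_eq_iff)
  have "axis undefined 1 \<noteq> (0 :: real^'n)" by (simp add: axis_eq_0_iff)
  from symmetric_max_rayleigh_eigenvector[OF symneg subspace_UNIV UNIV_I this UNIV_I]
  obtain \<mu> y where y: "y \<noteq> 0" "(- W) *v y = \<mu> *s y"
    and le: "\<And>y. y \<bullet> ((- W) *v y) \<le> \<mu> * (y \<bullet> y)"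
    by (metis UNIV_I)
  have "W *v y = (- \<mu>) *s y"
    using y(2) by (metis neg minus_equation_iff vector_sneg_minus1 vector_smult_assoc mult_minus1)
  then have "is_eigval W (- \<mu>)" using y(1) by (auto simp: is_eigval_def)
  then have "lambda_min W \<le> - \<mu>"
    unfolding lambda_min_def by (intro Min_le finite_eigvals) simp
  then have "lambda_min W * (x \<bullet> x) \<le> - \<mu> * (x \<bullet> x)"
    by (intro mult_right_mono) auto
  then show ?thesis using le[of x] by (simp add: neg)
qed

section \<open>Simplicity of a leading eigenvalue\<close>

text \<open>
  The entries of \<open>eigvals_desc\<close> are roots of the characteristic polynomial with their algebraic
  multiplicity, while positivity arguments only control eigenspaces. The two are linked by
  deflation: subtracting the projection onto a unit eigenvector moves one copy of its eigenvalue
  \<open>\<sigma>\<close> to \<open>\<sigma> - 1\<close> and leaves the other roots in place. If the eigenspace is a line, then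
  \<open>\<sigma>\<close> is no eigenvalue of the deflated matrix, so it was a simple root.
\<close>

definition outer_square :: "real^'n \<Rightarrow> real^'n^'n" where
  "outer_square a = (\<chi> i j. a $ i * a $ j)"

lemma outer_square_mult_vec: "outer_square a *v x = (a \<bullet> x) *\<^sub>R a"
  by (simp add: outer_square_def vec_eq_iff matrix_vector_mult_def inner_vec_def
      sum_distrib_left sum_distrib_right mult_ac)

text \<open>
  In an orthonormal basis that contains \<open>a\<close> the matrix is diagonal, with one entry \<open>1 + c\<close>
  and all others \<open>1\<close>.
\<close>

lemma det_one_plus_outer_square:
  fixes a :: "real^'n"
  assumes "norm a = 1"
  shows "det (mat 1 + c *\<^sub>R outer_square a) = 1 + c"
proof -
  fix k :: 'n
  obtain Q where Q: "orthogonal_matrix Q" "Q *v axis k 1 = a"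
    using orthogonal_matrix_exists_basis[OF assms] by metis
  define d where "d i = (if i = k then 1 + c else 1)" for i
  define D :: "real^'n^'n" where "D = (\<chi> i j. if i = j then d i else 0)"
  have D_vec: "D *v x = x + (c * x $ k) *\<^sub>R axis k 1" for x
  proof -
    have "(D *v x) $ i = d i * x $ i" for i
      by (simp add: D_def matrix_vector_mult_def if_distrib[of "\<lambda>y. y * _"] cong: if_cong)
    then show ?thesis by (simp add: d_def vec_eq_iff axis_def algebra_simps)
  qed
  have "det D = (\<Prod>i\<in>UNIV. D $ i $ i)" by (rule det_diagonal) (simp add: D_def)
  then have det_D: "det D = 1 + c" by (simp add: D_def d_def prod.delta)
  have "(mat 1 + c *\<^sub>R outer_square a) *v (Q *v x) = Q *v (D *v x)" for x
  proof -
    have "a \<bullet> (Q *v x) = x $ k"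
      using Q by (metis inner_axis' inner_matrix_vector_transpose matrix_vector_mul_assoc
          matrix_vector_mul_lid mult_1 orthogonal_matrix_def inner_real_def)
    then show ?thesis
      by (simp add: D_vec matrix_vector_mult_add_rdistrib matrix_vector_right_distrib
          matrix_vector_mult_scaleR outer_square_mult_vec Q(2) flip: scaleR_matrix_vector_assoc)
  qed
  then have "(mat 1 + c *\<^sub>R outer_square a) ** Q = Q ** D"
    by (simp add: matrix_eq flip: matrix_vector_mul_assoc)
  then have "det (mat 1 + c *\<^sub>R outer_square a) * det Q = det Q * det D"
    by (metis det_mul)
  moreover have "det Q \<noteq> 0" using det_orthogonal_matrix[OF Q(1)] by auto
  ultimately show ?thesis using det_D by simp
qed

lemma mat_mult_vec: "(mat c :: real^'n^'n) *v x = c *s x"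
  by (simp add: vec_eq_iff matrix_vector_mult_def mat_def if_distrib[of "\<lambda>y. y * _"] cong: if_cong)

text \<open>
  For \<open>c \<noteq> \<sigma>\<close> the vector \<open>a\<close> is an eigenvector of \<open>c - S\<close> for \<open>c - \<sigma>\<close>. The rank one
  update can therefore be pulled out as a right factor \<open>1 + (c - \<sigma>)\<^bsup>-1\<^esup> a a\<^sup>T\<close>, whose
  determinant is known.
\<close>

lemma charpoly_deflation:
  fixes S :: "real^'n^'n"
  assumes a: "norm a = 1" and Sa: "S *v a = \<sigma> *s a"
  shows "[:- \<sigma>, 1:] * charpoly (S - outer_square a) = [:1 - \<sigma>, 1:] * charpoly S"
proof -
  have "(c - \<sigma>) * det (mat c - (S - outer_square a)) = (c - \<sigma> + 1) * det (mat c - S)" for c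
  proof (cases "c = \<sigma>")
    case True
    have "a \<noteq> 0" using a by auto
    then have "is_eigval S \<sigma>" using Sa by (auto simp: is_eigval_def)
    then show ?thesis using True by (simp add: is_eigval_iff_charpoly poly_charpoly)
  next
    case False
    have "mat c - (S - outer_square a)
        = (mat c - S) ** (mat 1 + (1 / (c - \<sigma>)) *\<^sub>R outer_square a)"
    proof -
      have "(mat c - S) *v a = (c - \<sigma>) *s a"
        by (simp add: matrix_vector_mult_diff_rdistrib mat_mult_vec Sa vec_eq_iff algebra_simps)
      then have "(mat c - (S - outer_square a)) *v x
          = (mat c - S) *v ((mat 1 + (1 / (c - \<sigma>)) *\<^sub>R outer_square a) *v x)" for x
        using False
        by (simp add: matrix_vector_mult_add_rdistrib matrix_vector_mult_diff_rdistrib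
            matrix_vector_right_distrib matrix_vector_mult_scaleR outer_square_mult_vec
            scalar_mult_eq_scaleR flip: scaleR_matrix_vector_assoc)
      then show ?thesis
        by (intro matrix_eq[THEN iffD2] allI) (simp only: matrix_vector_mul_assoc)
    qed
    then have "det (mat c - (S - outer_square a)) = det (mat c - S) * (1 + 1 / (c - \<sigma>))"
      by (simp only: det_mul det_one_plus_outer_square[OF a])
    also have "(c - \<sigma>) * \<dots> = ((c - \<sigma>) * (1 + 1 / (c - \<sigma>))) * det (mat c - S)"
      by (simp only: mult_ac)
    also have "(c - \<sigma>) * (1 + 1 / (c - \<sigma>)) = c - \<sigma> + 1"
      using False by (simp add: distrib_left)
    finally show ?thesis .
  qed
  then have "poly ([:- \<sigma>, 1:] * charpoly (S - outer_square a)) = poly ([:1 - \<sigma>, 1:] * charpoly S)"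
    by (auto simp: poly_charpoly algebra_simps fun_eq_iff)
  then show ?thesis by (simp add: poly_eq_poly_eq_iff)
qed

lemma order_charpoly_eq_1:
  fixes S :: "real^'n^'n"
  assumes sym: "transpose S = S" and u: "u \<noteq> 0" and Su: "S *v u = \<sigma> *s u"
    and simple: "\<And>x. x \<bullet> u = 0 \<Longrightarrow> S *v x = \<sigma> *s x \<Longrightarrow> x = 0"
  shows "order \<sigma> (charpoly S) = 1"
proof -
  define a where "a = u /\<^sub>R norm u"
  have a: "norm a = 1" using u by (simp add: a_def)
  have Sa: "S *v a = \<sigma> *s a"
    by (simp add: a_def matrix_vector_mult_scaleR Su scalar_mult_eq_scaleR)
  have "\<not> is_eigval (S - outer_square a) \<sigma>"
  proof
    assume "is_eigval (S - outer_square a) \<sigma>"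
    then obtain x where x: "x \<noteq> 0" "S *v x - (a \<bullet> x) *\<^sub>R a = \<sigma> *\<^sub>R x"
      by (auto simp: is_eigval_def matrix_vector_mult_diff_rdistrib outer_square_mult_vec
          scalar_mult_eq_scaleR)
    have "a \<bullet> (S *v x) = \<sigma> * (a \<bullet> x)"
      using Sa by (simp add: inner_matrix_vector_transpose sym scalar_mult_eq_scaleR del: transpose_matrix_vector)
    moreover have "a \<bullet> a = 1" using a by (simp add: norm_eq_1)
    moreover have "a \<bullet> (S *v x - (a \<bullet> x) *\<^sub>R a) = \<sigma> * (a \<bullet> x)"
      by (simp add: x(2))
    ultimately have ax: "a \<bullet> x = 0" by (simp add: inner_diff_right)
    then have "x \<bullet> u = 0" using u by (simp add: a_def inner_commute)
    moreover have "S *v x = \<sigma> *s x" using x(2) ax by (simp add: scalar_mult_eq_scaleR)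
    ultimately show False using simple x(1) by blast
  qed
  then have "order \<sigma> (charpoly (S - outer_square a)) = 0"
    by (simp add: is_eigval_iff_charpoly order_0I)
  then have "order \<sigma> ([:- \<sigma>, 1:] * charpoly (S - outer_square a)) = 1"
    using order_power_n_n[of \<sigma> 1] order_mult[of "[:- \<sigma>, 1:]" "charpoly (S - outer_square a)" \<sigma>]
    by (simp add: charpoly_nonzero no_zero_divisors del: mult_pCons_left)
  moreover have "order \<sigma> [:1 - \<sigma>, 1:] = 0" by (rule order_0I) simp
  then have "order \<sigma> ([:1 - \<sigma>, 1:] * charpoly S) = order \<sigma> (charpoly S)"
    using order_mult[of "[:1 - \<sigma>, 1:]" "charpoly S" \<sigma>]
    by (simp add: charpoly_nonzero no_zero_divisors del: mult_pCons_left)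
  ultimately show ?thesis using charpoly_deflation[OF a Sa] by simp
qed

text \<open>
  Identifies the second entry of the descending list without describing the rest of the
  multiset.
\<close>

lemma rev_sorted_list_of_multiset_nth_1:
  fixes R :: "'a::linorder multiset"
  assumes "count R b = 1" "c \<in># R" "c < b" and le: "\<And>d. d \<in># R \<Longrightarrow> d \<noteq> b \<Longrightarrow> d \<le> c"
  shows "rev (sorted_list_of_multiset R) ! 1 = c"
proof -
  define R' where "R' = R - {#c, b#}"
  have "b \<in># R" using assms(1) by (metis count_eq_zero_iff zero_neq_one)
  then have "{#c, b#} \<subseteq># R"
    using assms by (auto simp: subseteq_mset_def count_greater_zero_iff Suc_le_eq)
  then have R: "R = R' + {#c, b#}" by (simp only: R'_def subset_mset.diff_add)
  have "count R b = count R' b + 1" using assms(3) by (simp add: R)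
  then have "b \<notin># R'" using assms(1) by (simp add: not_in_iff)
  then have R'_le: "\<And>d. d \<in># R' \<Longrightarrow> d \<le> c" using le by (metis R union_iff)
  have "sorted (sorted_list_of_multiset R' @ [c, b])"
    using R'_le assms(3) by (force simp: sorted_append)
  moreover have "R = mset (sorted_list_of_multiset R' @ [c, b])" by (subst R) simp
  ultimately have "sorted_list_of_multiset R = sorted_list_of_multiset R' @ [c, b]"
    by (metis sorted_list_of_multiset_mset sorted_sort_id)
  then show ?thesis by simp
qed

text \<open>
  Eigenvectors for eigenvalues other than \<open>\<sigma>\<close> are orthogonal to \<open>u\<close>, so the largest of
  these eigenvalues is the maximal Rayleigh quotient on the complement of \<open>u\<close>. It comes second
  in the list because \<open>\<sigma>\<close> is a simple root.
\<close>

lemma second_eigval_of_simple_leading: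
  fixes S :: "real^'n^'n"
  assumes n: "CARD('n) \<ge> 2" and sym: "transpose S = S" and u: "u \<noteq> 0" and Su: "S *v u = \<sigma> *s u"
    and gap: "\<And>x c. x \<noteq> 0 \<Longrightarrow> x \<bullet> u = 0 \<Longrightarrow> S *v x = c *s x \<Longrightarrow> c < \<sigma>"
  defines "\<mu> \<equiv> eigvals_desc S ! 1"
  obtains x where "x \<noteq> 0" "S *v x = \<mu> *s x" "\<mu> < \<sigma>"
    "\<And>y. y \<bullet> u = 0 \<Longrightarrow> y \<bullet> (S *v y) \<le> \<mu> * (y \<bullet> y)"
proof -
  define V where "V = {x. u \<bullet> x = 0}"
  have V: "subspace V" by (simp add: V_def subspace_hyperplane)
  have Su_inner: "u \<bullet> (S *v x) = \<sigma> * (u \<bullet> x)" for x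
    using Su sym by (simp add: inner_matrix_vector_transpose scalar_mult_eq_scaleR del: transpose_matrix_vector)
  then have inv: "\<And>x. x \<in> V \<Longrightarrow> S *v x \<in> V" by (simp add: V_def)
  have "dim {u} < DIM(real^'n)" using n u by simp
  then obtain z where z: "z \<noteq> 0" "\<And>y. y \<in> span {u} \<Longrightarrow> orthogonal z y"
    using orthogonal_to_subspace_exists by metis
  then have "z \<in> V" using span_base[of u "{u}"] by (simp add: V_def orthogonal_def inner_commute)
  with z(1) V sym inv obtain c x where x: "x \<in> V" "x \<noteq> 0" "S *v x = c *s x"
    and c: "\<And>y. y \<in> V \<Longrightarrow> y \<bullet> (S *v y) \<le> c * (y \<bullet> y)"
    using symmetric_max_rayleigh_eigenvector[of S V z] by metis
  have c_less: "c < \<sigma>" using gap x by (simp add: V_def inner_commute)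
  have "order \<sigma> (charpoly S) = 1"
    using order_charpoly_eq_1[OF sym u Su] gap by blast
  then have "count (proots (charpoly S)) \<sigma> = 1" by (simp add: charpoly_nonzero)
  moreover have "c \<in># proots (charpoly S)"
    using x by (auto simp: charpoly_nonzero is_eigval_def simp flip: is_eigval_iff_charpoly)
  moreover have "d \<le> c" if d: "d \<in># proots (charpoly S)" "d \<noteq> \<sigma>" for d
  proof -
    have "is_eigval S d" using d by (simp add: charpoly_nonzero is_eigval_iff_charpoly)
    then obtain y where y: "y \<noteq> 0" "S *v y = d *s y" by (auto simp: is_eigval_def)
    have "\<sigma> * (u \<bullet> y) = d * (u \<bullet> y)"
      using Su_inner[of y] y(2) by (auto simp: scalar_mult_eq_scaleR)
    then have "u \<bullet> y = 0" using d(2) by (metis mult_right_cancel)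
    then have "y \<in> V" by (simp add: V_def)
    from c[OF this] show "d \<le> c" using y by (simp add: scalar_mult_eq_scaleR)
  qed
  ultimately have "\<mu> = c"
    unfolding \<mu>_def eigvals_desc_def using c_less by (intro rev_sorted_list_of_multiset_nth_1) auto
  then show ?thesis using that[of x] x c c_less by (simp add: V_def inner_commute)
qed

section \<open>Spectral gap of primitive symmetric matrices\<close>

text \<open>
  With \<open>f\<^sub>i = x\<^sub>i / u\<^sub>i\<close>, the eigenvector equation for \<open>u\<close> gives the identity
  \<open>\<Sum>\<^sub>i\<^sub>j P\<^sub>i\<^sub>j u\<^sub>i u\<^sub>j (f\<^sub>i - f\<^sub>j)\<^sup>2 = 2 (\<rho> x\<^sup>T x - x\<^sup>T P x)\<close>. Since all weights are
  positive, the left side vanishes only if \<open>f\<close> is constant, that is if \<open>x\<close> is a multiple of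
  \<open>u\<close>; orthogonality to \<open>u\<close> rules this out.
\<close>

lemma positive_symmetric_rayleigh_less:
  fixes P :: "real^'n^'n"
  assumes pos: "pos_matrix P" and sym: "transpose P = P"
    and u: "\<forall>i. 0 < u $ i" and Pu: "P *v u = \<rho> *s u" and x: "x \<noteq> 0" "x \<bullet> u = 0"
  shows "x \<bullet> (P *v x) < \<rho> * (x \<bullet> x)"
proof -
  define f where "f i = x $ i / u $ i" for i
  have xf: "x $ i = u $ i * f i" for i using u by (simp add: f_def less_imp_neq[symmetric])
  define E where "E = (\<Sum>i\<in>UNIV. \<Sum>j\<in>UNIV. P $ i $ j * u $ i * u $ j * (f i - f j)\<^sup>2)"
  have Psym: "P $ i $ j = P $ j $ i" for i j 
    using arg_cong[OF sym, of "\<lambda>X. X $ j $ i"] by (simp add: transpose_def)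
  have Pu': "(\<Sum>j\<in>UNIV. P $ i $ j * u $ j) = \<rho> * u $ i" for i
    using Pu by (simp add: matrix_vector_mult_def vec_eq_iff)
  (* The square (f i)^2 summed over j gives the diagonal part of the identity; by symmetry
     of P the same sum results from (f j)^2. *)
  have xx: "\<rho> * (x \<bullet> x) = (\<Sum>i\<in>UNIV. \<Sum>j\<in>UNIV. P $ i $ j * u $ i * u $ j * (f i)\<^sup>2)"
  proof -
    have "(\<Sum>j\<in>UNIV. P $ i $ j * u $ i * u $ j * (f i)\<^sup>2) = \<rho> * (x $ i * x $ i)" for i
    proof -
      have "(\<Sum>j\<in>UNIV. P $ i $ j * u $ i * u $ j * (f i)\<^sup>2)
          = (\<Sum>j\<in>UNIV. P $ i $ j * u $ j) * (u $ i * (f i)\<^sup>2)"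
        unfolding sum_distrib_right by (intro sum.cong) (simp_all add: mult_ac)
      then show ?thesis unfolding Pu' by (simp add: xf power2_eq_square mult_ac)
    qed
    then show ?thesis by (simp add: inner_vec_def sum_distrib_left)
  qed
  also have "\<dots> = (\<Sum>i\<in>UNIV. \<Sum>j\<in>UNIV. P $ i $ j * u $ i * u $ j * (f j)\<^sup>2)"
    by (subst sum.swap) (simp add: Psym mult_ac)
  finally have xx': "\<rho> * (x \<bullet> x) = (\<Sum>i\<in>UNIV. \<Sum>j\<in>UNIV. P $ i $ j * u $ i * u $ j * (f j)\<^sup>2)" .
  have xPx: "x \<bullet> (P *v x) = (\<Sum>i\<in>UNIV. \<Sum>j\<in>UNIV. P $ i $ j * u $ i * u $ j * (f i * f j))"
    by (simp add: inner_vec_def matrix_vector_mult_def sum_distrib_left xf mult_ac)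
  have "E = \<rho> * (x \<bullet> x) + \<rho> * (x \<bullet> x) - 2 * (x \<bullet> (P *v x))"
    unfolding E_def xPx by (subst xx, subst xx')
      (simp add: power2_diff algebra_simps sum.distrib sum_subtractf sum_distrib_left)
  moreover have "0 < E"
  proof (rule ccontr)
    have nonneg: "0 \<le> P $ i $ j * u $ i * u $ j * (f i - f j)\<^sup>2" for i j
      using pos u by (intro mult_nonneg_nonneg) (auto simp: pos_matrix_def less_imp_le)
    assume "\<not> 0 < E"
    then have "E = 0" unfolding E_def using nonneg by (meson not_le order_antisym sum_nonneg)
    then have "P $ i $ j * u $ i * u $ j * (f i - f j)\<^sup>2 = 0" for i j
      unfolding E_def using nonneg by (simp add: sum_nonneg_eq_0_iff sum_nonneg)
    moreover have "P $ i $ j * u $ i * u $ j \<noteq> 0" for i j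
      using pos u by (simp add: pos_matrix_def less_imp_neq[symmetric])
    ultimately have const: "f i = f j" for i j by simp
    define k where "k = f undefined"
    have xk: "x = k *\<^sub>R u" using xf const[of _ undefined] by (simp add: vec_eq_iff k_def mult_ac)
    have "u \<noteq> 0" using u by (metis less_irrefl zero_index)
    then have "k = 0" using x(2) by (simp add: xk)
    then show False using x(1) xk by simp
  qed
  ultimately show ?thesis by linarith
qed

lemma matrix_pow_Suc_right: "matrix_pow A (Suc k) = matrix_pow A k ** A"
proof (induction k)
  case (Suc k)
  have "matrix_pow A (Suc (Suc k)) = A ** (matrix_pow A k ** A)" using Suc by simp
  then show ?case by (simp add: matrix_mul_assoc)
qed simp

lemma transpose_matrix_pow:
  "transpose (matrix_pow A k) = matrix_pow (transpose A) k" for A :: "real^'n^'n"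
proof (induction k)
  case (Suc k)
  have "transpose (matrix_pow A (Suc k)) = matrix_pow (transpose A) k ** transpose A"
    using Suc by (simp add: matrix_transpose_mul)
  then show ?case by (simp add: matrix_pow_Suc_right del: matrix_pow.simps(2))
qed simp

lemma matrix_pow_eigenvector:
  fixes A :: "real^'n^'n"
  assumes "A *v x = c *s x"
  shows "matrix_pow A k *v x = (c ^ k) *s x"
proof (induction k)
  case (Suc k)
  have "matrix_pow A (Suc k) *v x = A *v ((c ^ k) *s x)"
    by (simp add: Suc flip: matrix_vector_mul_assoc)
  then show ?case
    using assms by (simp add: matrix_vector_mult_scaleR scalar_mult_eq_scaleR)
qed simp

text \<open>
  The zero pattern of a power of a nonnegative matrix depends only on the zero pattern of the
  matrix. This transports primitivity from \<open>A A\<^sup>T\<close> to its rescaling \<open>A\<^sup>S\<close>.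
\<close>

lemma matrix_pow_pos_mono:
  fixes X Y :: "real^'n^'n"
  assumes X: "nonneg_matrix X" and Y: "nonneg_matrix Y"
    and imp: "\<And>i j. 0 < X $ i $ j \<Longrightarrow> 0 < Y $ i $ j"
  shows "0 < matrix_pow X k $ i $ j \<Longrightarrow> 0 < matrix_pow Y k $ i $ j"
proof (induction k arbitrary: i)
  case (Suc k)
  have nn: "0 \<le> matrix_pow Z k $ i $ j" if "nonneg_matrix Z" for Z :: "real^'n^'n" and k i j
    using that by (induction k arbitrary: i)
      (auto simp: mat_def matrix_matrix_mult_def nonneg_matrix_def intro!: sum_nonneg)
  have "(\<Sum>l\<in>UNIV. X $ i $ l * matrix_pow X k $ l $ j) \<noteq> 0"
    using Suc.prems by (simp add: matrix_matrix_mult_def)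
  then obtain l where l: "X $ i $ l * matrix_pow X k $ l $ j \<noteq> 0"
    by (meson sum.not_neutral_contains_not_neutral)
  have "0 < X $ i $ l" "0 < matrix_pow X k $ l $ j"
    using l X nn[OF X] by (auto simp: nonneg_matrix_def less_le)
  then have "0 < Y $ i $ l * matrix_pow Y k $ l $ j"
    using Suc.IH imp by simp
  moreover have "0 \<le> Y $ i $ l * matrix_pow Y k $ l $ j" for l
    using Y nn[OF Y] by (simp add: nonneg_matrix_def)
  ultimately show ?case
    by (auto simp: matrix_matrix_mult_def intro!: sum_pos2[of _ l])
qed (simp add: mat_def)

text \<open>
  A positive power \<open>S\<^sup>k\<close> has the eigenvectors of \<open>S\<close>, with eigenvalues raised to the power
  \<open>k\<close>, so the strict inequality \<open>c\<^sup>k < \<sigma>\<^sup>k\<close> for positive matrices yields the gap for \<open>S\<close>.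
\<close>

lemma primitive_symmetric_gap:
  fixes S :: "real^'n^'n"
  assumes prim: "primitive_matrix S" and sym: "transpose S = S"
    and u: "\<forall>i. 0 < u $ i" and Su: "S *v u = \<sigma> *s u" and \<sigma>: "0 \<le> \<sigma>"
    and x: "x \<noteq> 0" "x \<bullet> u = 0" and Sx: "S *v x = c *s x"
  shows "c < \<sigma>"
proof -
  obtain k where k: "pos_matrix (matrix_pow S k)" using prim by (auto simp: primitive_matrix_def)
  have "x \<bullet> (matrix_pow S k *v x) < \<sigma> ^ k * (x \<bullet> x)"
    using k sym u x Su by (intro positive_symmetric_rayleigh_less[where u = u])
      (auto simp: transpose_matrix_pow matrix_pow_eigenvector)
  then have "c ^ k < \<sigma> ^ k"
    using x(1) by (simp add: matrix_pow_eigenvector[OF Sx] scalar_mult_eq_scaleR)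
  then show ?thesis using \<sigma> by (rule power_less_imp_less_base)
qed

section \<open>The leading eigenvalue of a marginally stable matrix\<close>

text \<open>
  Along the eigenvector the norm of the powers is at least \<open>\<bar>l\<bar>\<^sup>t\<close>, which is unbounded if
  \<open>\<bar>l\<bar> > 1\<close>.
\<close>

lemma marginally_stable_eigval_le_1:
  fixes A :: "real^'n^'n"
  assumes "marginally_stable A" "A *v v = l *s v" "v \<noteq> 0"
  shows "\<bar>l\<bar> \<le> 1"
proof (rule ccontr)
  assume "\<not> \<bar>l\<bar> \<le> 1"
  moreover obtain C where C: "\<And>t. \<bar>onorm ((*v) (matrix_pow A t))\<bar> \<le> C"
    using assms(1) by (auto simp: marginally_stable_def bounded_iff)
  ultimately obtain t where t: "C < \<bar>l\<bar> ^ t" using real_arch_pow by (metis not_le)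
  have "norm (matrix_pow A t *v v) \<le> onorm ((*v) (matrix_pow A t)) * norm v"
    by (simp add: onorm matrix_vector_mul_bounded_linear)
  then have "\<bar>l\<bar> ^ t \<le> onorm ((*v) (matrix_pow A t))"
    using assms(3) by (simp add: matrix_pow_eigenvector[OF assms(2)] scalar_mult_eq_scaleR power_abs)
  then show False using C[of t] t by linarith
qed

section \<open>The quadratic form of the Gramian\<close>

lemma transpose_gramian: "transpose (gramian A B T) = gramian A B T"
proof -
  have "transpose (matrix_pow A \<tau> ** B ** transpose B ** matrix_pow (transpose A) \<tau>)
      = matrix_pow A \<tau> ** B ** transpose B ** matrix_pow (transpose A) \<tau>" for \<tau>
    by (simp add: matrix_transpose_mul transpose_matrix_pow matrix_mul_assoc)
  then show ?thesis
    by (simp add: gramian_def transpose_def vec_eq_iff)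
qed

lemma sum_matrix_vector_mult:
  "(\<Sum>i\<in>I. F i) *v x = (\<Sum>i\<in>I. F i *v x)" for F :: "'i \<Rightarrow> real^'n^'m"
  by (induction I rule: infinite_finite_induct) (simp_all add: matrix_vector_mult_add_rdistrib)

text \<open>
  The quadratic form of the Gramian is the energy that the dual system \<open>x \<mapsto> A\<^sup>T x\<close>, started
  at \<open>x\<close>, shows at the control nodes.
\<close>

lemma gramian_quadratic_form:
  fixes A :: "real^'n^'n"
  shows "x \<bullet> (gramian A (input_matrix K) T *v x)
    = (\<Sum>\<tau><T. \<Sum>k\<in>K. ((matrix_pow (transpose A) \<tau> *v x) $ k)\<^sup>2)"
proof -
  have "x \<bullet> ((matrix_pow A \<tau> ** B ** transpose B ** matrix_pow (transpose A) \<tau>) *v x)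
      = (\<Sum>k\<in>K. ((matrix_pow (transpose A) \<tau> *v x) $ k)\<^sup>2)"
    if B: "B = input_matrix K" for \<tau> and B :: "real^'n^'n"
  proof -
    define y where "y = matrix_pow (transpose A) \<tau> *v x"
    have "x \<bullet> ((matrix_pow A \<tau> ** B ** transpose B ** matrix_pow (transpose A) \<tau>) *v x)
        = (transpose B *v y) \<bullet> (transpose B *v y)"
      by (simp add: y_def inner_matrix_vector_transpose transpose_matrix_pow
          del: transpose_matrix_vector flip: matrix_vector_mul_assoc)
    moreover have "(transpose B *v y) $ k = (if k \<in> K then y $ k else 0)" for k
      by (auto simp: matrix_vector_mult_def transpose_def B input_matrix_def axis_def
          if_distrib[of "\<lambda>y. y * _"] simp del: transpose_matrix_vector cong: if_cong)
    then have "(transpose B *v y) \<bullet> (transpose B *v y) = (\<Sum>k\<in>UNIV. if k \<in> K then (y $ k)\<^sup>2 else 0)"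
      by (auto simp: inner_vec_def power2_eq_square simp del: transpose_matrix_vector intro!: sum.cong)
    ultimately show ?thesis by (simp add: sum.If_cases y_def)
  qed
  then show ?thesis by (simp add: gramian_def sum_matrix_vector_mult inner_sum_right)
qed

section \<open>Decay orthogonal to the leading eigenvector\<close>

text \<open>
  Both claims are proved together: the contraction is available only on the orthogonal complement
  of \<open>u\<close>, and the orbit stays there because \<open>u\<close> is an eigenvector of the transpose.
\<close>

lemma matrix_pow_decay_orthogonal:
  fixes N :: "real^'n^'n"
  assumes Nu: "transpose N *v u = l *s u" and \<mu>: "0 \<le> \<mu>"
    and contr: "\<And>z. z \<bullet> u = 0 \<Longrightarrow> (norm (N *v z))\<^sup>2 \<le> \<mu> * (norm z)\<^sup>2"
    and y: "y \<bullet> u = 0"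
  shows "(norm (matrix_pow N t *v y))\<^sup>2 \<le> \<mu> ^ t * (norm y)\<^sup>2"
    and "(matrix_pow N t *v y) \<bullet> u = 0"
proof (induction t)
  case (Suc t)
  {
    case 1
    have "(norm (N *v (matrix_pow N t *v y)))\<^sup>2 \<le> \<mu> * (norm (matrix_pow N t *v y))\<^sup>2"
      by (rule contr[OF Suc(2)])
    also have "\<dots> \<le> \<mu> * (\<mu> ^ t * (norm y)\<^sup>2)"
      using Suc(1) \<mu> by (rule mult_left_mono)
    finally show ?case by (simp add: matrix_vector_mul_assoc mult.assoc)
  next
    case 2
    have "u \<bullet> (N *v (matrix_pow N t *v y)) = (l *s u) \<bullet> (matrix_pow N t *v y)"
      unfolding inner_matrix_vector_transpose Nu ..
    also have "\<dots> = 0" using Suc(2) by (simp add: scalar_mult_eq_scaleR inner_commute)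
    finally have "u \<bullet> (N *v (matrix_pow N t *v y)) = 0" .
    then show ?case by (simp add: matrix_vector_mul_assoc inner_commute)
  }
qed (use y in auto)

text \<open>
  The conditions say that \<open>y\<close> is orthogonal to \<open>u\<close> and to the rows with index in \<open>K\<close> of
  the first \<open>s\<close> powers of \<open>N\<close>. These are too few vectors to span the whole space.
\<close>

lemma exists_orthogonal_with_vanishing_outputs:
  fixes N :: "real^'n^'n"
  assumes "s * card K + 1 < CARD('n)"
  obtains y where "y \<noteq> 0" "y \<bullet> u = 0" "\<And>t k. t < s \<Longrightarrow> k \<in> K \<Longrightarrow> (matrix_pow N t *v y) $ k = 0"
proof -
  define F where "F = insert u ((\<lambda>(t, k). matrix_pow N t $ k) ` ({..<s} \<times> K))"
  have "card F \<le> Suc (card ((\<lambda>(t, k). matrix_pow N t $ k) ` ({..<s} \<times> K)))"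
    unfolding F_def by (rule card_insert_le_m1) auto
  also have "\<dots> \<le> s * card K + 1"
    using card_image_le[of "{..<s} \<times> K" "\<lambda>(t, k). matrix_pow N t $ k"]
    by (simp add: card_cartesian_product)
  finally have "card F < DIM(real^'n)" using assms by simp
  moreover have "dim F \<le> card F" by (rule dim_le_card') (simp add: F_def)
  ultimately obtain y where y: "y \<noteq> 0" "\<And>z. z \<in> span F \<Longrightarrow> orthogonal y z"
    using orthogonal_to_subspace_exists[of F] by (metis le_less_trans)
  then have orth: "z \<bullet> y = 0" if "z \<in> F" for z
    using y(2)[OF span_base[OF that]] by (simp add: orthogonal_def inner_commute)
  show ?thesis
  proof
    show "y \<noteq> 0" by (rule y(1))
    show "y \<bullet> u = 0" using orth[of u] by (simp add: F_def inner_commute)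
    fix t k assume "t < s" "k \<in> K"
    then have "matrix_pow N t $ k \<in> F" by (force simp: F_def)
    then show "(matrix_pow N t *v y) $ k = 0" by (simp add: matrix_vector_mul_component orth)
  qed
qed

text \<open>
  The outputs vanish before time \<open>s\<close>, and from then on they are dominated by a geometric
  series.
\<close>

lemma sum_outputs_le:
  fixes N :: "real^'n^'n"
  assumes Nu: "transpose N *v u = l *s u" and \<mu>: "0 \<le> \<mu>" "\<mu> < 1"
    and contr: "\<And>z. z \<bullet> u = 0 \<Longrightarrow> (norm (N *v z))\<^sup>2 \<le> \<mu> * (norm z)\<^sup>2"
    and y: "y \<bullet> u = 0" and zero: "\<And>t k. t < s \<Longrightarrow> k \<in> K \<Longrightarrow> (matrix_pow N t *v y) $ k = 0"
  shows "(\<Sum>t<T. \<Sum>k\<in>K. ((matrix_pow N t *v y) $ k)\<^sup>2) \<le> \<mu> ^ s / (1 - \<mu>) * (norm y)\<^sup>2"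
proof -
  have out: "(\<Sum>k\<in>K. ((matrix_pow N t *v y) $ k)\<^sup>2) \<le> (if s \<le> t then \<mu> ^ t * (norm y)\<^sup>2 else 0)" for t
  proof (cases "s \<le> t")
    case True
    have "(\<Sum>k\<in>K. ((matrix_pow N t *v y) $ k)\<^sup>2) \<le> (\<Sum>k\<in>UNIV. ((matrix_pow N t *v y) $ k)\<^sup>2)"
      by (rule sum_mono2) auto
    also have "\<dots> = (matrix_pow N t *v y) \<bullet> (matrix_pow N t *v y)"
      by (simp add: inner_vec_def power2_eq_square)
    also have "\<dots> = (norm (matrix_pow N t *v y))\<^sup>2" by (rule dot_square_norm)
    also have "\<dots> \<le> \<mu> ^ t * (norm y)\<^sup>2"
      by (rule matrix_pow_decay_orthogonal[OF Nu \<mu>(1) contr y])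
    finally show ?thesis using True by simp
  qed (simp add: zero)
  have "(\<Sum>t<T. \<Sum>k\<in>K. ((matrix_pow N t *v y) $ k)\<^sup>2) \<le> (\<Sum>t<T. if s \<le> t then \<mu> ^ t * (norm y)\<^sup>2 else 0)"
    by (intro sum_mono out)
  (* Extending the horizon by s leaves exactly T terms and avoids a case distinction on s < T. *)
  also have "\<dots> \<le> (\<Sum>t<T + s. if s \<le> t then \<mu> ^ t * (norm y)\<^sup>2 else 0)"
    using \<mu> by (intro sum_mono2) auto
  also have "\<dots> = (\<Sum>t\<in>{s..<T + s}. \<mu> ^ t * (norm y)\<^sup>2)"
    by (intro sum.mono_neutral_cong_right) auto
  also have "\<dots> = (\<Sum>t<T. \<mu> ^ (t + s) * (norm y)\<^sup>2)"
    using sum.shift_bounds_nat_ivl[of "\<lambda>t. \<mu> ^ t * (norm y)\<^sup>2" 0 s T] by (simp add: lessThan_atLeast0)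
  also have "\<dots> = (\<Sum>t<T. \<mu> ^ t) * (\<mu> ^ s * (norm y)\<^sup>2)"
    unfolding power_add sum_distrib_right by (simp only: mult_ac)
  also have "\<dots> \<le> 1 / (1 - \<mu>) * (\<mu> ^ s * (norm y)\<^sup>2)"
    using \<mu> by (intro mult_right_mono) (simp_all add: sum_gp_strict divide_right_mono)
  finally show ?thesis by simp
qed

section \<open>The balanced matrix\<close>

definition balance :: "real^'n \<Rightarrow> real^'n^'n \<Rightarrow> real^'n^'n" where
  "balance p A = (\<chi> i j. p $ i * A $ i $ j / p $ j)"

abbreviation root_pi :: "real^'n \<Rightarrow> real^'n \<Rightarrow> real^'n" where
  "root_pi v w \<equiv> (\<chi> i. sqrt (w $ i / v $ i))"

lemma diag_mult: "(diag d ** X) $ i $ j = d $ i * X $ i $ j"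
  for X :: "'a::semiring_1^'n^'m"
  by (simp add: diag_def matrix_matrix_mult_def if_distrib[of "\<lambda>y. y * _"] cong: if_cong)

lemma mult_diag: "(X ** diag d) $ i $ j = X $ i $ j * d $ j"
  for X :: "'a::semiring_1^'n^'m"
  by (simp add: diag_def matrix_matrix_mult_def if_distrib[of "\<lambda>y. _ * y"] cong: if_cong)

lemma matrix_mult_entry: "(X ** Y) $ i $ j = (\<Sum>l\<in>UNIV. X $ i $ l * Y $ l $ j)"
  by (simp add: matrix_matrix_mult_def)

text \<open>
  This exhibits \<open>A\<^sup>S\<close> as a Gram matrix, so its quadratic form is the squared norm of
  \<open>M\<^sup>T z\<close>: eigenvalue bounds for \<open>A\<^sup>S\<close> become contraction rates of \<open>M\<^sup>T\<close>.
\<close>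

lemma A_S_eq_balance:
  fixes A :: "real^'n^'n"
  assumes v: "\<forall>i. 0 < v $ i" and w: "\<forall>i. 0 < w $ i"
  defines "M \<equiv> balance (root_pi v w) A"
  shows "A_S A v w = M ** transpose M"
proof -
  define r where "r i = w $ i / v $ i" for i
  have r: "0 < r i" for i using v w by (simp add: r_def)
  have "A_S A v w $ i $ j = (M ** transpose M) $ i $ j" for i j
  proof -
    have minus_half: "r j powr (- 1 / 2) = 1 / sqrt (r j)"
      using r[of j] powr_minus_divide[of "r j" "1 / 2"] by (simp add: powr_half_sqrt)
    have left: "(Pi_pow v w (1/2) ** A) $ i $ l = sqrt (r i) * A $ i $ l" for l
      using r by (simp add: Pi_pow_def diag_mult powr_half_sqrt less_imp_le flip: r_def)
    have right: "A_R A v w $ l $ j = 1 / r l * A $ j $ l * r j" for l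
      using r by (simp add: A_R_def Pi_pow_def mult_diag diag_mult transpose_def powr_minus_divide
          less_imp_le flip: r_def)
    have "A_S A v w $ i $ j = (Pi_pow v w (1/2) ** A ** A_R A v w) $ i $ j * (1 / sqrt (r j))"
      using minus_half by (simp add: A_S_def Pi_pow_def[of v w "- (1 / 2)"] mult_diag flip: r_def)
    also have "\<dots> = (\<Sum>l\<in>UNIV. (sqrt (r i) * A $ i $ l) * (1 / r l * A $ j $ l * r j)) * (1 / sqrt (r j))"
      unfolding matrix_mult_entry[of "Pi_pow v w (1/2) ** A"] left right ..
    also have "\<dots> = (\<Sum>l\<in>UNIV. M $ i $ l * M $ j $ l)"
      unfolding sum_distrib_right
    proof (rule sum.cong)
      fix l
      have "r l = sqrt (r l) * sqrt (r l)" "r j = sqrt (r j) * sqrt (r j)" for l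
        using r by (simp_all add: less_imp_le)
      moreover have "sqrt (r l) \<noteq> 0" "sqrt (r j) \<noteq> 0" using r[of l] r[of j] by simp_all
      ultimately show "sqrt (r i) * A $ i $ l * (1 / r l * A $ j $ l * r j) * (1 / sqrt (r j))
          = M $ i $ l * M $ j $ l"
        by (simp add: M_def balance_def r_def[symmetric] field_simps)
    qed simp
    finally show ?thesis by (simp add: matrix_matrix_mult_def transpose_def)
  qed
  then show ?thesis by (simp add: vec_eq_iff)
qed

text \<open>
  The scaling by \<open>sqrt (w\<^sub>i / v\<^sub>i)\<close> sends \<open>v\<close> to the geometric mean of \<open>v\<close> and \<open>w\<close>,
  and its inverse sends \<open>w\<close> to the same vector.
\<close>

lemma balance_leading_eigenvectors:
  fixes A :: "real^'n^'n"
  assumes v: "\<forall>i. 0 < v $ i" and w: "\<forall>i. 0 < w $ i"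
    and Av: "A *v v = l *s v" and Aw: "transpose A *v w = l *s w"
  defines "u \<equiv> (\<chi> i. sqrt (w $ i / v $ i) * v $ i)"
  shows "balance (root_pi v w) A *v u = l *s u"
    and "transpose (balance (root_pi v w) A) *v u = l *s u"
proof -
  define p where "p i = sqrt (w $ i / v $ i)" for i
  have p: "p i \<noteq> 0" for i using v w by (simp add: p_def less_imp_neq[symmetric])
  have w_eq: "w $ i = p i * p i * v $ i" for i
    using v w by (simp add: p_def less_imp_le less_imp_neq[symmetric])
  have Av': "(\<Sum>j\<in>UNIV. A $ i $ j * v $ j) = l * v $ i" for i
    using Av by (simp add: matrix_vector_mult_def vec_eq_iff)
  have Aw': "(\<Sum>i\<in>UNIV. A $ i $ j * w $ i) = l * w $ j" for j
    using Aw by (simp add: matrix_vector_mult_def vec_eq_iff transpose_def del: transpose_matrix_vector)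
  have "(\<Sum>j\<in>UNIV. p i * A $ i $ j / p j * (p j * v $ j)) = p i * (\<Sum>j\<in>UNIV. A $ i $ j * v $ j)" for i
    unfolding sum_distrib_left using p by (intro sum.cong) (simp_all add: field_simps)
  then show "balance (root_pi v w) A *v u = l *s u"
    by (simp add: u_def balance_def p_def[symmetric] vec_eq_iff matrix_vector_mult_def Av')
  have "(\<Sum>i\<in>UNIV. p i * A $ i $ j / p j * (p i * v $ i)) = l * (p j * v $ j)" for j
  proof -
    have "(\<Sum>i\<in>UNIV. p i * A $ i $ j / p j * (p i * v $ i)) = (\<Sum>i\<in>UNIV. A $ i $ j * w $ i) / p j"
      unfolding sum_divide_distrib by (intro sum.cong) (simp_all add: w_eq mult_ac)
    also have "\<dots> = l * (p j * v $ j)" using p by (simp add: Aw' w_eq[of j])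
    finally show ?thesis .
  qed
  then show "transpose (balance (root_pi v w) A) *v u = l *s u"
    by (simp add: u_def balance_def p_def[symmetric] vec_eq_iff matrix_vector_mult_def
        transpose_def del: transpose_matrix_vector)
qed

lemma matrix_pow_transpose_balance:
  fixes A :: "real^'n^'n" and p y :: "real^'n"
  assumes p: "\<forall>i. p $ i \<noteq> 0"
  shows "matrix_pow (transpose A) t *v (\<chi> i. p $ i * y $ i)
    = (\<chi> i. p $ i * (matrix_pow (transpose (balance p A)) t *v y) $ i)"
proof (induction t)
  case (Suc t)
  have "transpose A *v (\<chi> i. p $ i * z $ i) = (\<chi> i. p $ i * (transpose (balance p A) *v z) $ i)" for z
    using p by (auto simp: vec_eq_iff matrix_vector_mult_def transpose_def balance_def sum_distrib_left
        simp del: transpose_matrix_vector intro!: sum.cong)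
  then show ?case
    using Suc by (simp del: transpose_matrix_vector flip: matrix_vector_mul_assoc)
qed simp

text \<open>
  The spectral input of the whole argument: \<open>\<sigma>\<^sub>2\<close> lies in \<open>[0, 1)\<close>, and it is the rate at
  which the transposed balanced matrix contracts squared norms orthogonally to \<open>u\<close>.
\<close>

lemma second_eigval_A_S:
  fixes A :: "real^'n^'n"
  assumes n: "CARD('n) \<ge> 2" and A: "nonneg_matrix A" and stable: "marginally_stable A"
    and v: "\<forall>i. 0 < v $ i" and Av: "A *v v = l *s v"
    and w: "\<forall>i. 0 < w $ i" and Aw: "transpose A *v w = l *s w"
    and prim: "primitive_matrix (A ** transpose A)"
  defines "M \<equiv> balance (root_pi v w) A" and "u \<equiv> (\<chi> i. sqrt (w $ i / v $ i) * v $ i)"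
    and "\<mu> \<equiv> eigvals_desc (A_S A v w) ! 1"
  shows "0 \<le> \<mu>" "\<mu> < 1"
    and "\<And>z. z \<bullet> u = 0 \<Longrightarrow> (norm (transpose M *v z))\<^sup>2 \<le> \<mu> * (norm z)\<^sup>2"
proof -
  define S where "S = M ** transpose M"
  have S: "A_S A v w = S" unfolding S_def M_def by (rule A_S_eq_balance[OF v w])
  have sym: "transpose S = S" by (simp add: S_def matrix_transpose_mul)
  have quad: "z \<bullet> (S *v z) = (norm (transpose M *v z))\<^sup>2" for z
  proof -
    have "z \<bullet> (S *v z) = (transpose M *v z) \<bullet> (transpose M *v z)"
      by (simp only: S_def inner_matrix_vector_transpose[of z M] flip: matrix_vector_mul_assoc)
    then show ?thesis by (simp only: dot_square_norm)
  qed
  have Mu: "M *v u = l *s u" "transpose M *v u = l *s u"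
    using balance_leading_eigenvectors[OF v w Av Aw] by (simp_all only: M_def u_def)
  have Su: "S *v u = l\<^sup>2 *s u"
    by (simp add: S_def Mu matrix_vector_mult_scaleR scalar_mult_eq_scaleR power2_eq_square
        del: transpose_matrix_vector flip: matrix_vector_mul_assoc)
  have u: "\<forall>i. 0 < u $ i" using v w by (simp add: u_def)
  then have "u \<noteq> 0" by (metis less_irrefl zero_index)
  have root_pos: "0 < sqrt (w $ i / v $ i)" for i using v w by simp
  have Sprim: "primitive_matrix S"
  proof -
    have nn: "nonneg_matrix (A ** transpose A)"
      using A by (auto simp: nonneg_matrix_def matrix_matrix_mult_def transpose_def intro!: sum_nonneg)
    have M: "0 \<le> M $ i $ j" for i j
      using A root_pos[of i] root_pos[of j] by (simp add: M_def balance_def nonneg_matrix_def)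
    have "nonneg_matrix S"
      using M by (auto simp: S_def nonneg_matrix_def matrix_matrix_mult_def transpose_def intro!: sum_nonneg)
    moreover have "0 < S $ i $ j" if "0 < (A ** transpose A) $ i $ j" for i j
    proof -
      have "(\<Sum>h\<in>UNIV. A $ i $ h * A $ j $ h) \<noteq> 0"
        using that by (simp add: matrix_matrix_mult_def transpose_def)
      then obtain h where h: "A $ i $ h * A $ j $ h \<noteq> 0"
        by (meson sum.not_neutral_contains_not_neutral)
      then have "0 < A $ i $ h" "0 < A $ j $ h" using A by (auto simp: nonneg_matrix_def less_le)
      then have "0 < M $ i $ h * M $ j $ h"
        unfolding M_def balance_def vec_lambda_beta
        by (intro divide_pos_pos mult_pos_pos root_pos)
      then show ?thesis
        using M by (auto simp: S_def matrix_matrix_mult_def transpose_def intro!: sum_pos2[of _ h])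
    qed
    ultimately show ?thesis
      using prim nn unfolding primitive_matrix_def pos_matrix_def by (meson matrix_pow_pos_mono)
  qed
  obtain x where x: "x \<noteq> 0" "S *v x = \<mu> *s x" "\<mu> < l\<^sup>2"
    and le: "\<And>y. y \<bullet> u = 0 \<Longrightarrow> y \<bullet> (S *v y) \<le> \<mu> * (y \<bullet> y)"
    using second_eigval_of_simple_leading[OF n sym \<open>u \<noteq> 0\<close> Su]
      primitive_symmetric_gap[OF Sprim sym u Su] unfolding \<mu>_def S by (metis zero_le_power2)
  have "\<mu> * (x \<bullet> x) = (norm (transpose M *v x))\<^sup>2"
    using quad[of x] x(2) by (simp add: scalar_mult_eq_scaleR del: transpose_matrix_vector)
  then have "0 \<le> \<mu> * (x \<bullet> x)" by simp
  moreover have "0 < x \<bullet> x" using x(1) by simp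
  ultimately show "0 \<le> \<mu>" by (simp add: zero_le_mult_iff)
  have "v \<noteq> 0" using v by (metis less_irrefl zero_index)
  then have "\<bar>l\<bar> \<le> 1" by (rule marginally_stable_eigval_le_1[OF stable Av])
  then have "l\<^sup>2 \<le> 1" by (simp add: abs_square_le_1)
  then show "\<mu> < 1" using x(3) by simp
  show "(norm (transpose M *v z))\<^sup>2 \<le> \<mu> * (norm z)\<^sup>2" if "z \<bullet> u = 0" for z
    using le[OF that] by (simp only: quad dot_square_norm)
qed

section \<open>The bound on the smallest eigenvalue of the Gramian\<close>

text \<open>
  The vector \<open>x\<close> with entries \<open>sqrt (w\<^sub>i / v\<^sub>i) y\<^sub>i\<close> serves as a test vector in the Rayleigh
  quotient, where \<open>y\<close> has vanishing outputs before time \<open>s\<close>. In passing from \<open>y\<close> to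
  \<open>x\<close>, the numerator grows at most by the largest and the denominator at least by the smallest
  of the \<open>w\<^sub>i / v\<^sub>i\<close>.
\<close>

lemma lambda_min_gramian_le_power:
  fixes A :: "real^'n^'n"
  assumes n: "CARD('n) \<ge> 2" and A: "nonneg_matrix A" and stable: "marginally_stable A"
    and v: "\<forall>i. 0 < v $ i" and Av: "A *v v = l *s v"
    and w: "\<forall>i. 0 < w $ i" and Aw: "transpose A *v w = l *s w"
    and prim: "primitive_matrix (A ** transpose A)"
    and s: "s * card K + 1 < CARD('n)"
  defines "\<mu> \<equiv> eigvals_desc (A_S A v w) ! 1"
    and "R \<equiv> range (\<lambda>i. w $ i / v $ i)"
  shows "lambda_min (gramian A (input_matrix K) T) \<le> Max R / Min R * (\<mu> ^ s / (1 - \<mu>))"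
proof -
  define p where "p = root_pi v w"
  define N where "N = transpose (balance p A)"
  define u where "u = (\<chi> i. sqrt (w $ i / v $ i) * v $ i)"
  have \<mu>: "0 \<le> \<mu>" "\<mu> < 1"
    and contr: "\<And>z. z \<bullet> u = 0 \<Longrightarrow> (norm (N *v z))\<^sup>2 \<le> \<mu> * (norm z)\<^sup>2"
    using second_eigval_A_S[OF n A stable v Av w Aw prim]
    by (simp_all only: \<mu>_def N_def p_def u_def)
  have Nu: "transpose N *v u = l *s u"
    using balance_leading_eigenvectors(1)[OF v w Av Aw]
    by (simp only: N_def p_def u_def transpose_transpose)
  obtain y where y: "y \<noteq> 0" "y \<bullet> u = 0" "\<And>t k. t < s \<Longrightarrow> k \<in> K \<Longrightarrow> (matrix_pow N t *v y) $ k = 0"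
    using exists_orthogonal_with_vanishing_outputs[OF s] by blast
  define x where "x = (\<chi> i. p $ i * y $ i)"
  have p_sq: "(p $ i)\<^sup>2 = w $ i / v $ i" for i
    using v w by (simp add: p_def less_imp_le)
  have p_nz: "\<forall>i. p $ i \<noteq> 0" using v w by (simp add: p_def less_imp_neq[symmetric])
  have R: "finite R" "R \<noteq> {}" "\<And>i. w $ i / v $ i \<in> R" by (auto simp: R_def)
  have R_pos: "0 < Min R" using R v w by (subst Min_gr_iff) (auto simp: R_def)
  have "Min R \<le> Max R" using R by simp
  then have Max_nonneg: "0 \<le> Max R" using R_pos by linarith
  have "x \<bullet> (gramian A (input_matrix K) T *v x)
      = (\<Sum>t<T. \<Sum>k\<in>K. (w $ k / v $ k) * ((matrix_pow N t *v y) $ k)\<^sup>2)"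
    by (simp add: gramian_quadratic_form x_def matrix_pow_transpose_balance[OF p_nz] power_mult_distrib
        p_sq N_def)
  also have "\<dots> \<le> (\<Sum>t<T. \<Sum>k\<in>K. Max R * ((matrix_pow N t *v y) $ k)\<^sup>2)"
    using R by (intro sum_mono mult_right_mono Max_ge) auto
  also have "\<dots> = Max R * (\<Sum>t<T. \<Sum>k\<in>K. ((matrix_pow N t *v y) $ k)\<^sup>2)"
    by (simp add: sum_distrib_left)
  also have "\<dots> \<le> Max R * (\<mu> ^ s / (1 - \<mu>) * (norm y)\<^sup>2)"
  proof (rule mult_left_mono[OF _ Max_nonneg])
    show "(\<Sum>t<T. \<Sum>k\<in>K. ((matrix_pow N t *v y) $ k)\<^sup>2) \<le> \<mu> ^ s / (1 - \<mu>) * (norm y)\<^sup>2"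
      by (rule sum_outputs_le[OF Nu \<mu> contr y(2,3)])
  qed
  finally have upper: "x \<bullet> (gramian A (input_matrix K) T *v x) \<le> Max R * (\<mu> ^ s / (1 - \<mu>) * (norm y)\<^sup>2)" .
  define c where "c = Max R / Min R * (\<mu> ^ s / (1 - \<mu>))"
  have c: "0 \<le> c"
    using R_pos Max_nonneg \<mu> by (simp add: c_def)
  have lower: "Min R * (norm y)\<^sup>2 \<le> x \<bullet> x"
  proof -
    have "Min R * (norm y)\<^sup>2 = Min R * (y \<bullet> y)" by (simp only: dot_square_norm)
    also have "\<dots> = (\<Sum>i\<in>UNIV. Min R * (y $ i)\<^sup>2)"
      by (simp add: sum_distrib_left inner_vec_def power2_eq_square)
    also have "\<dots> \<le> (\<Sum>i\<in>UNIV. (w $ i / v $ i) * (y $ i)\<^sup>2)"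
      using R by (intro sum_mono mult_right_mono Min_le) auto
    also have "\<dots> = x \<bullet> x"
      by (simp add: x_def inner_vec_def power_mult_distrib flip: p_sq power2_eq_square)
    finally show ?thesis .
  qed
  have "0 < Min R * (norm y)\<^sup>2" using R_pos y(1) by simp
  then have xx: "0 < x \<bullet> x" using lower by linarith
  have "lambda_min (gramian A (input_matrix K) T) * (x \<bullet> x) \<le> x \<bullet> (gramian A (input_matrix K) T *v x)"
    by (rule lambda_min_le_rayleigh[OF transpose_gramian])
  also have "\<dots> \<le> c * (Min R * (norm y)\<^sup>2)"
    using upper R_pos by (simp add: c_def)
  also have "\<dots> \<le> c * (x \<bullet> x)" by (rule mult_left_mono[OF lower c])
  finally show ?thesis
    unfolding c_def[symmetric] using xx by (rule mult_right_le_imp_le)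
qed

theorem theorem1:
  fixes A :: "real^'n^'n" and v w :: "real^'n" and lambda1 sigma2 :: real
    and K :: "'n set" and m T :: nat
  assumes "CARD('n) \<ge> 2"
    and "nonneg_matrix A" and "irreducible_matrix A" and "marginally_stable A"
    and "leading_eigval A lambda1"
    and "\<forall>i. 0 < v $ i" and "A *v v = lambda1 *s v"
    and "\<forall>i. 0 < w $ i" and "transpose A *v w = lambda1 *s w"
    and "sigma2 = eigvals_desc (A_S A v w) ! 1"
    and "primitive_matrix (A ** transpose A)"
    and "card K = m"
  shows
    "(sigma2 \<noteq> 0 \<longrightarrow>
        lambda_min (gramian A (input_matrix K) T)
          \<le> Max (range (\<lambda>i. w $ i / v $ i)) / Min (range (\<lambda>i. w $ i / v $ i))
             * (sigma2 powr (real CARD('n) / real m) / (sigma2\<^sup>2 * (1 - sigma2))))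
     \<and> \<comment> \<open>for sigma2 = 0 the quotient is read as sigma2 to the power n/m - 2, divided by 1 - sigma2\<close>
     (sigma2 = 0 \<longrightarrow>
        (real CARD('n) / real m > 2 \<longrightarrow> lambda_min (gramian A (input_matrix K) T) \<le> 0) \<and>
        (real CARD('n) / real m = 2 \<longrightarrow> lambda_min (gramian A (input_matrix K) T)
          \<le> Max (range (\<lambda>i. w $ i / v $ i)) / Min (range (\<lambda>i. w $ i / v $ i))))"
proof -
  (* The least natural number with s >= n/m - 2. It satisfies s < n/m - 1 if it is positive,
     which leaves room for the extra condition of orthogonality to the leading eigenvector.
     For empty K the quotient n/m is 0 and s = 0. *)
  define s where "s = nat (\<lceil>real CARD('n) / real m\<rceil> - 2)"
  define R where "R = range (\<lambda>i. w $ i / v $ i)"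
  have s_ge: "real CARD('n) / real m - 2 \<le> real s"
    unfolding s_def by linarith
  have s_card: "s * m + 1 < CARD('n)"
  proof (cases "s = 0")
    case False
    then have m: "0 < m" by (cases "m = 0") (auto simp: s_def)
    have "real s < real CARD('n) / real m - 1"
      using False unfolding s_def by linarith
    then have "real s * real m < real CARD('n) - real m"
      using m by (simp add: field_simps)
    then have "real (s * m + m) < real CARD('n)" by simp
    then show ?thesis using m by (simp only: of_nat_less_iff)
  qed (use assms(1) in simp)
  have sigma2: "0 \<le> sigma2" "sigma2 < 1"
    using second_eigval_A_S(1,2)[OF assms(1,2,4,6-9,11)] by (simp_all only: assms(10))
  have bound: "lambda_min (gramian A (input_matrix K) T) \<le> Max R / Min R * (sigma2 ^ s / (1 - sigma2))"
    using lambda_min_gramian_le_power[OF assms(1,2,4,6-9,11)] s_card assms(12)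
    by (simp add: assms(10) R_def)
  have ratio: "0 \<le> Max R / Min R"
    by (intro divide_nonneg_nonneg) (use assms(6,8) in \<open>auto simp: R_def Max_ge_iff Min_ge_iff less_imp_le\<close>)
  show ?thesis
    unfolding R_def[symmetric]
  proof (intro conjI impI)
    assume "sigma2 \<noteq> 0"
    then have pos: "0 < sigma2" using sigma2 by simp
    have "sigma2 ^ s = sigma2 powr real s" using pos by (simp add: powr_realpow)
    also have "\<dots> \<le> sigma2 powr (real CARD('n) / real m - 2)"
      using pos sigma2(2) s_ge by (intro powr_mono') auto
    also have "\<dots> = sigma2 powr (real CARD('n) / real m) / sigma2\<^sup>2"
      using pos by (simp add: powr_diff powr_numeral)
    finally have "sigma2 ^ s / (1 - sigma2)
        \<le> sigma2 powr (real CARD('n) / real m) / (sigma2\<^sup>2 * (1 - sigma2))"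
      using sigma2(2) by (simp add: divide_right_mono flip: divide_divide_eq_left)
    with bound show "lambda_min (gramian A (input_matrix K) T)
        \<le> Max R / Min R * (sigma2 powr (real CARD('n) / real m) / (sigma2\<^sup>2 * (1 - sigma2)))"
      using mult_left_mono[OF _ ratio] order_trans by blast
  next
    assume "sigma2 = 0" "real CARD('n) / real m > 2"
    (* The power 0 ^ s vanishes for s > 0, whereas in the borderline case n/m = 2 below
       s = 0 and 0 ^ 0 = 1. *)
    moreover from this s_ge have "0 < s" by linarith
    ultimately show "lambda_min (gramian A (input_matrix K) T) \<le> 0"
      using bound by (simp add: power_0_left)
  next
    assume "sigma2 = 0" "real CARD('n) / real m = 2"
    then show "lambda_min (gramian A (input_matrix K) T) \<le> Max R / Min R"
      using bound by (simp add: s_def)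
  qed
qed

end
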